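(* Let $F$ be a finite field, let $n>1$ be an integer, and let $k,m$ be integers with $0\le k\le m\le n$. An $n\times n$ matrix $A$ over $F$ with rank $r$ is a sum of two $n\times n$ matrices over $F$, one of rank $k$ and one of rank $m$, if and only if $m-k\le r\le\min\{m+k,n\}$. Consequently, $$V_k+V_m=\bigsqcup_{i=m-k}^{\min\{m+k,n\}}V_i.$$
   Context: For $0\le i\le n$, $V_i$ denotes the set of all matrices of rank $i$ in the ring $M_n(F)$ of $n\times n$ matrices over $F$ (so $V_0=\{0\}$). For subsets $X,Y\subset M_n(F)$, $X+Y=\{x+y\mid x\in X,\ y\in Y\}$. *)

theory Defs
  imports "HOL-Analysis.Analysis" "HOL-Library.Set_Algebras" "HOL-Library.Disjoint_Sets"
begin

text \<open>
  Here \<open>n = CARD('n)\<close>.  The constant \<^const>\<open>rank\<close> is the row rank, defined over an arbitrary field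
  through \<open>vec.dim\<close>; several of its library lemmas are stated only over the reals.
\<close>

definition rank_set :: "nat \<Rightarrow> ('a::field^'n^'n) set"
  where "rank_set i = {A. rank A = i}"

end

theory Submission
  imports Defs
begin

text \<open>
  The bounds on the rank are subadditivity. Conversely, two matrices of equal rank are equivalent, so
  only the triple \<open>(rank B, rank C, rank (B + C))\<close> matters. Since \<open>B = (B + C) + (- C)\<close>, the set of
  realisable triples is symmetric, and it suffices to realise \<open>k \<le> m \<le> r \<le> k + m\<close> with \<open>B + C\<close> a
  coordinate projection of rank \<open>r\<close> and \<open>B\<close> built from a nilpotent shift and an idempotent. The
  construction needs no scalars other than \<open>0\<close>, \<open>1\<close> and \<open>-1\<close>, so it covers the field with two elements.
  It fails only when all three ranks equal \<open>n\<close>; there \<open>B\<close> is a companion matrix without eigenvalues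
  \<open>0\<close> and \<open>1\<close>.
\<close>

section \<open>Rank of negatives, sums and products\<close>

lemma rows_eq_range: "rows A = range (\<lambda>i. A $ i)"
  by (auto simp: rows_def row_def vec_lambda_eta)

lemma rank_le_card: "rank (A :: 'a::field^'n^'m) \<le> CARD('n)"
  unfolding row_rank_def_gen by (rule dim_subset_UNIV_cart_gen)

lemma rank_uminus: "rank (- A :: 'a::field^'n^'m) = rank A"
proof -
  have le: "rank (- B) \<le> rank B" for B :: "'a^'n^'m"
    unfolding row_rank_def_gen rows_eq_range
    by (rule vec.dim_mono) (auto intro: vec.span_neg vec.span_base)
  show ?thesis
    using le[of A] le[of "- A"] by simp
qed

lemma rank_add_le: "rank (A + B :: 'a::field^'n^'m) \<le> rank A + rank B"
proof -
  obtain S where S: "vec.independent S" "rows A \<subseteq> vec.span S" "card S = rank A"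
    using vec.basis_exists[of "rows A"] unfolding row_rank_def_gen by metis
  obtain T where T: "vec.independent T" "rows B \<subseteq> vec.span T" "card T = rank B"
    using vec.basis_exists[of "rows B"] unfolding row_rank_def_gen by metis
  have "A $ i + B $ i \<in> vec.span (S \<union> T)" for i
  proof (rule vec.span_add)
    show "A $ i \<in> vec.span (S \<union> T)"
      using S(2) vec.span_mono[of S "S \<union> T"] by (auto simp: rows_eq_range)
    show "B $ i \<in> vec.span (S \<union> T)"
      using T(2) vec.span_mono[of T "S \<union> T"] by (auto simp: rows_eq_range)
  qed
  then have "rank (A + B) \<le> card (S \<union> T)"
    unfolding row_rank_def_gen rows_eq_range
    using S(1) T(1) by (intro vec.dim_le_card) (auto simp: vec.finiteI_independent)
  also have "\<dots> \<le> card S + card T"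
    by (rule card_Un_le)
  finally show ?thesis
    using S T by simp
qed

lemma matrix_add_rdistrib: "(A + B) ** C = A ** C + B ** (C :: 'a::semiring_1^'p^'n)"
  by (simp add: matrix_matrix_mult_def vec_eq_iff distrib_right sum.distrib)

lemma matrix_mult_row: "(A ** B) $ i = (\<Sum>j\<in>UNIV. A $ i $ j *s B $ j)"
  by (simp add: matrix_matrix_mult_def vec_eq_iff sum_component)

lemma rank_mult_le_right: "rank (A ** B :: 'a::field^'n^'m) \<le> rank B"
  unfolding row_rank_def_gen
  by (rule vec.dim_mono)
    (auto simp: rows_eq_range matrix_mult_row intro!: vec.span_sum vec.span_scale intro: vec.span_base)

text \<open>Multiplying by \<open>B\<close> on the right applies one linear map to every row of
  \<open>A\<close>, and linear maps do not raise dimension.\<close>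

lemma rank_mult_le_left:
  fixes A :: "'a::field^'n^'m" and B :: "'a^'p^'n"
  shows "rank (A ** B) \<le> rank A"
proof -
  have "(A ** B) $ i = transpose B *v (A $ i)" for i
    by (simp add: matrix_matrix_mult_def matrix_vector_mult_def transpose_def mult.commute)
  then have "rows (A ** B) = (*v) (transpose B) ` rows A"
    by (auto simp: rows_eq_range)
  then show ?thesis
    unfolding row_rank_def_gen
    by (metis vec.dim_image_le matrix_vector_mul_linear_gen)
qed

lemma rank_mult_invertible:
  fixes A P Q :: "'a::field^'n^'n"
  assumes "invertible P" "invertible Q"
  shows "rank (P ** A ** Q) = rank A"
proof (rule antisym)
  obtain P' where P': "P' ** P = mat 1" using assms(1) invertible_left_inverse by blast
  obtain Q' where Q': "Q ** Q' = mat 1" using assms(2) invertible_right_inverse by blast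
  show "rank (P ** A ** Q) \<le> rank A"
    using rank_mult_le_left[of "P ** A" Q] rank_mult_le_right[of P A] by linarith
  have "P' ** (P ** A ** Q) ** Q' = (P' ** P) ** A ** (Q ** Q')"
    by (simp add: matrix_mul_assoc)
  also have "\<dots> = A"
    by (simp add: P' Q')
  finally show "rank A \<le> rank (P ** A ** Q)"
    using rank_mult_le_left[of "P' ** (P ** A ** Q)" Q'] rank_mult_le_right[of P' "P ** A ** Q"]
    by simp
qed

section \<open>Criteria for computing a rank\<close>

lemma rank_eq_card:
  fixes M :: "'a::field^'n^'m"
  assumes zero: "\<And>i. i \<notin> I \<Longrightarrow> M $ i = 0"
    and indep: "\<And>c i. (\<Sum>i\<in>I. c i *s M $ i) = 0 \<Longrightarrow> i \<in> I \<Longrightarrow> c i = 0"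
  shows "rank M = card I"
proof -
  have inj: "inj_on (\<lambda>i. M $ i) I"
  proof (rule inj_onI, rule ccontr)
    fix i j assume ij: "i \<in> I" "j \<in> I" "M $ i = M $ j" "i \<noteq> j"
    \<comment> \<open>Two equal rows would satisfy the relation with coefficients 1 and -1.\<close>
    let ?c = "\<lambda>x. if x = i then 1 else if x = j then -1 else (0::'a)"
    have "(\<Sum>x\<in>I. ?c x *s M $ x) = (\<Sum>x\<in>{i,j}. ?c x *s M $ x)"
      using ij by (intro sum.mono_neutral_right) auto
    also have "\<dots> = 0"
      using ij by simp
    finally have "?c i = 0"
      using indep[of ?c i] ij by blast
    then show False by simp
  qed
  have "vec.independent ((\<lambda>i. M $ i) ` I)"
  proof (rule vec.independent_if_scalars_zero)
    fix f x
    assume "(\<Sum>x\<in>(\<lambda>i. M $ i) ` I. f x *s x) = 0" and x: "x \<in> (\<lambda>i. M $ i) ` I"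
    then have "(\<Sum>i\<in>I. f (M $ i) *s M $ i) = 0"
      by (simp add: sum.reindex[OF inj])
    then show "f x = 0"
      using indep[of "\<lambda>i. f (M $ i)"] x by auto
  qed simp
  moreover have "vec.span (rows M) = vec.span ((\<lambda>i. M $ i) ` I)"
  proof (rule vec.span_eq[THEN iffD2], intro conjI)
    show "rows M \<subseteq> vec.span ((\<lambda>i. M $ i) ` I)"
      using zero by (force simp: rows_eq_range intro: vec.span_base vec.span_zero)
    show "(\<lambda>i. M $ i) ` I \<subseteq> vec.span (rows M)"
      by (auto simp: rows_eq_range intro: vec.span_base)
  qed
  ultimately show ?thesis
    unfolding row_rank_def_gen
    by (metis card_image inj vec.dim_span_eq_card_independent vec.dim_span)
qed

text \<open>In a vanishing combination, take a row \<open>j\<close> of least \<open>h\<close> among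
  those with nonzero coefficient: in column \<open>p j\<close> only its own entry survives. Rows
  tied under \<open>h\<close> must vanish in each other's pivot columns.\<close>

lemma rank_echelon:
  fixes M :: "'a::field^'n^'m" and h :: "'m \<Rightarrow> nat"
  assumes zero: "\<And>i. i \<notin> I \<Longrightarrow> M $ i = 0"
    and pivot: "\<And>i. i \<in> I \<Longrightarrow> M $ i $ p i \<noteq> 0"
    and echelon: "\<And>i j. i \<in> I \<Longrightarrow> j \<in> I \<Longrightarrow> i \<noteq> j \<Longrightarrow> h j \<le> h i \<Longrightarrow> M $ i $ p j = 0"
  shows "rank M = card I"
proof (rule rank_eq_card[OF zero])
  fix c i
  assume sum0: "(\<Sum>i\<in>I. c i *s M $ i) = 0" and "i \<in> I"
  show "c i = 0"
  proof (rule ccontr)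
    assume "c i \<noteq> 0"
    then obtain j where j: "j \<in> I" "c j \<noteq> 0" and min: "\<And>x. x \<in> I \<Longrightarrow> c x \<noteq> 0 \<Longrightarrow> h j \<le> h x"
      using ex_has_least_nat[of "\<lambda>x. x \<in> I \<and> c x \<noteq> 0" i h] \<open>i \<in> I\<close> by blast
    have "0 = (\<Sum>x\<in>I. c x *s M $ x) $ p j"
      using sum0 by simp
    also have "\<dots> = (\<Sum>x\<in>I. c x * M $ x $ p j)"
      by (simp add: sum_component)
    also have "\<dots> = (\<Sum>x\<in>I. if x = j then c j * M $ j $ p j else 0)"
      using min echelon j by (intro sum.cong) auto
    also have "\<dots> = c j * M $ j $ p j"
      using j by simp
    finally show False
      using pivot j by simp
  qed
qed

section \<open>Rank normal form and equivalence of matrices\<close>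

definition coord_proj :: "'n set \<Rightarrow> 'a::field^'n^'n" where
  "coord_proj S = (\<chi> i j. if i = j \<and> i \<in> S then 1 else 0)"

lemma coord_proj_mult_row: "(coord_proj S ** A) $ i = (if i \<in> S then A $ i else 0)"
proof -
  have "(coord_proj S ** A) $ i = (\<Sum>j\<in>UNIV. if j = i then (if i \<in> S then A $ i else 0) else 0)"
    unfolding matrix_mult_row by (rule sum.cong) (auto simp: coord_proj_def)
  then show ?thesis by simp
qed

lemma row_selection:
  fixes A :: "'a::field^'n^'n"
  obtains S where "card S = rank A" "inj_on (\<lambda>i. A $ i) S" "vec.independent ((\<lambda>i. A $ i) ` S)"
    "rows A \<subseteq> vec.span ((\<lambda>i. A $ i) ` S)"
proof -
  obtain B where B: "B \<subseteq> rows A" "vec.independent B" "rows A \<subseteq> vec.span B" "card B = vec.dim (rows A)"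
    using vec.basis_exists[of "rows A"] by metis
  obtain S where S: "inj_on (\<lambda>i. A $ i) S" "B = (\<lambda>i. A $ i) ` S"
    using B(1) subset_image_inj[of B "\<lambda>i. A $ i" UNIV] by (auto simp: rows_eq_range)
  show ?thesis
    by (rule that[of S]) (use S B in \<open>auto simp: row_rank_def_gen card_image\<close>)
qed

text \<open>The rows outside \<open>S\<close> can be cleared and then restored by row operations
  \<open>mat 1 + N\<close> that add combinations of rows in \<open>S\<close>.\<close>

lemma left_factor_through_rows:
  fixes A :: "'a::field^'n^'n"
  assumes span: "rows A \<subseteq> vec.span ((\<lambda>i. A $ i) ` S)"
    and inj: "inj_on (\<lambda>i. A $ i) S"
  obtains L where "invertible L" "A = L ** (coord_proj S ** A)"
proof -
  have "\<exists>c. A $ i = (\<Sum>j\<in>S. c j *s A $ j)" for i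
  proof -
    have "A $ i \<in> vec.span ((\<lambda>i. A $ i) ` S)"
      using span by (auto simp: rows_eq_range)
    then obtain u where "A $ i = (\<Sum>v\<in>(\<lambda>i. A $ i) ` S. u v *s v)"
      by (auto simp: vec.span_finite)
    then show ?thesis
      by (intro exI[of _ "\<lambda>j. u (A $ j)"]) (simp add: sum.reindex[OF inj])
  qed
  then obtain c where c: "\<And>i. A $ i = (\<Sum>j\<in>S. c i j *s A $ j)"
    by metis
  define N :: "'a^'n^'n" where "N = (\<chi> i j. if i \<notin> S \<and> j \<in> S then c i j else 0)"
  \<comment> \<open>The columns where \<open>N\<close> is nonzero lie in \<open>S\<close>, its
    nonzero rows outside \<open>S\<close>; hence \<open>mat 1 - N\<close> is the inverse of
    \<open>mat 1 + N\<close>.\<close>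
  have "N ** N = 0"
    by (auto simp: vec_eq_iff matrix_matrix_mult_def N_def intro!: sum.neutral)
  moreover have "N ** (- N) = - (N ** N)"
    by (simp add: vec_eq_iff matrix_matrix_mult_def sum_negf)
  ultimately have "(mat 1 + N) ** (mat 1 + - N) = mat 1"
    by (simp add: matrix_add_ldistrib matrix_add_rdistrib del: add_uminus_conv_diff)
  then have "invertible (mat 1 + N)"
    using invertible_right_inverse by blast
  moreover have "A = (mat 1 + N) ** (coord_proj S ** A)"
  proof (rule vec_eq_iff[THEN iffD2], rule allI)
    fix i
    have "(N ** (coord_proj S ** A)) $ i = (\<Sum>j\<in>UNIV. N $ i $ j *s (if j \<in> S then A $ j else 0))"
      by (simp add: matrix_mult_row[of N] coord_proj_mult_row)
    also have "\<dots> = (\<Sum>j\<in>S. N $ i $ j *s A $ j)"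
      by (rule sum.mono_neutral_cong_right) auto
    also have "\<dots> = (if i \<in> S then 0 else A $ i)"
      by (auto simp: N_def c[of i])
    finally show "A $ i = ((mat 1 + N) ** (coord_proj S ** A)) $ i"
      by (simp add: matrix_add_rdistrib coord_proj_mult_row)
  qed
  ultimately show ?thesis
    using that by blast
qed

text \<open>The chosen rows extend to a basis of the whole space; its new vectors fill the positions
  outside \<open>S\<close>.\<close>

lemma extend_rows_invertible:
  fixes A :: "'a::field^'n^'n"
  assumes inj: "inj_on (\<lambda>i. A $ i) S"
    and indep: "vec.independent ((\<lambda>i. A $ i) ` S)"
  obtains Y where "invertible Y" "\<And>i. i \<in> S \<Longrightarrow> Y $ i = A $ i"
proof -
  let ?B = "(\<lambda>i. A $ i) ` S"
  define E where "E = vec.extend_basis ?B"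
  have E: "?B \<subseteq> E" "vec.independent E" "vec.span E = UNIV"
    using vec.extend_basis_superset[OF indep] vec.independent_extend_basis[OF indep]
      vec.span_extend_basis[OF indep] by (auto simp: E_def)
  have finE: "finite E"
    using E(2) by (rule vec.finiteI_independent)
  have cardE: "card E = CARD('n)"
    using E(2,3) by (metis vec.dim_span_eq_card_independent vec_dim_card)
  have "card (E - ?B) = card (- S)"
    using E(1) finE cardE inj
    by (simp add: card_Diff_subset Compl_eq_Diff_UNIV card_image finite_subset)
  then obtain f where f: "bij_betw f (- S) (E - ?B)"
    using finE by (metis finite_Diff finite_same_card_bij finite_class.finite)
  define Y where "Y = (\<chi> i. if i \<in> S then A $ i else f i)"
  have "rows Y = (\<lambda>i. Y $ i) ` S \<union> (\<lambda>i. Y $ i) ` (- S)"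
    by (auto simp: rows_eq_range)
  also have "(\<lambda>i. Y $ i) ` S = ?B"
    by (simp add: Y_def)
  also have "(\<lambda>i. Y $ i) ` (- S) = E - ?B"
    using f by (simp add: Y_def bij_betw_def)
  also have "?B \<union> (E - ?B) = E"
    using E(1) by blast
  finally have "rows Y = E" .
  then have "invertible Y"
    using E(3) matrix_left_invertible_span_rows_gen invertible_left_inverse by metis
  then show ?thesis
    using that[of Y] by (simp add: Y_def)
qed

text \<open>A permutation of the indices carrying \<open>S\<close> onto \<open>T\<close> gives
  mutually inverse permutation matrices \<open>P\<close> and \<open>Q\<close>.\<close>

lemma coord_proj_similar:
  fixes S T :: "'n::finite set"
  assumes "card S = card T"
  obtains P Q :: "'a::field^'n^'n" where "invertible P" "invertible Q"
    "coord_proj S = P ** coord_proj T ** Q"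
proof -
  obtain f where f: "bij_betw f S T"
    using assms finite_same_card_bij[of S T] by auto
  obtain g where g: "bij_betw g (- S) (- T)"
    using assms finite_same_card_bij[of "- S" "- T"] by (auto simp: Compl_eq_Diff_UNIV card_Diff_subset)
  define \<pi> where "\<pi> = (\<lambda>i. if i \<in> S then f i else g i)"
  have "bij_betw \<pi> (S \<union> - S) (T \<union> - T)"
    unfolding \<pi>_def by (rule bij_betw_disjoint_Un[OF f g]) auto
  then have bij: "bij \<pi>" by simp
  have mem: "\<pi> i \<in> T \<longleftrightarrow> i \<in> S" for i
    using f g by (auto simp: \<pi>_def bij_betw_def)
  define P :: "'a^'n^'n" where "P = (\<chi> i j. if \<pi> i = j then 1 else 0)"
  define Q :: "'a^'n^'n" where "Q = (\<chi> i j. if i = \<pi> j then 1 else 0)"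
  have row: "(P ** A) $ i = A $ \<pi> i" for A :: "'a^'n^'n" and i
  proof -
    have "(P ** A) $ i = (\<Sum>j\<in>UNIV. if j = \<pi> i then A $ \<pi> i else 0)"
      unfolding matrix_mult_row by (rule sum.cong) (auto simp: P_def)
    then show ?thesis by simp
  qed
  have PQ: "P ** Q = mat 1"
    using bij by (auto simp: vec_eq_iff row Q_def mat_def bij_def inj_eq)
  have "P ** coord_proj T ** Q = coord_proj S"
    using bij by (auto simp: vec_eq_iff row coord_proj_mult_row Q_def mem bij_def inj_eq
        simp flip: matrix_mul_assoc) (simp_all add: coord_proj_def)
  moreover have "invertible P" "invertible Q"
    using PQ invertible_left_inverse invertible_right_inverse by blast+
  ultimately show ?thesis
    using that by metis
qed

text \<open>After projection to the basis rows \<open>S\<close>, \<open>A\<close> agrees with an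
  invertible \<open>Y\<close>. Leaving \<open>T\<close> free lets two matrices of equal rank share
  one normal form.\<close>

lemma rank_normal_form:
  fixes A :: "'a::field^'n^'n"
  assumes "card (T :: 'n set) = rank A"
  obtains P Q where "invertible P" "invertible Q" "A = P ** coord_proj T ** Q"
proof -
  obtain S where S: "card S = rank A" "inj_on (\<lambda>i. A $ i) S" "vec.independent ((\<lambda>i. A $ i) ` S)"
    "rows A \<subseteq> vec.span ((\<lambda>i. A $ i) ` S)"
    by (rule row_selection)
  obtain L where L: "invertible L" "A = L ** (coord_proj S ** A)"
    using left_factor_through_rows[OF S(4,2)] .
  obtain Y where Y: "invertible Y" "\<And>i. i \<in> S \<Longrightarrow> Y $ i = A $ i"
    using extend_rows_invertible[OF S(2,3)] by metis
  obtain P Q :: "'a^'n^'n" where PQ: "invertible P" "invertible Q" "coord_proj S = P ** coord_proj T ** Q"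
    using coord_proj_similar[of S T] S(1) assms by auto
  have "coord_proj S ** A = coord_proj S ** Y"
    by (simp add: vec_eq_iff[of "coord_proj S ** A"] coord_proj_mult_row Y(2))
  then have "A = L ** (P ** coord_proj T ** Q ** Y)"
    using L(2) PQ(3) by simp
  then have "A = (L ** P) ** coord_proj T ** (Q ** Y)"
    by (simp add: matrix_mul_assoc)
  then show ?thesis
    using that L(1) Y(1) PQ(1,2) invertible_mult by blast
qed

lemma rank_eq_imp_equivalent:
  fixes A B :: "'a::field^'n^'n"
  assumes "rank A = rank B"
  obtains P Q where "invertible P" "invertible Q" "A = P ** B ** Q"
proof -
  obtain T :: "'n set" where T: "card T = rank B"
    using obtain_subset_with_card_n[OF rank_le_card[of B]] by metis
  obtain P Q where A: "invertible P" "invertible Q" "A = P ** coord_proj T ** Q"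
    using rank_normal_form[of T A] T assms by metis
  obtain P' Q' where B: "invertible P'" "invertible Q'" "B = P' ** coord_proj T ** Q'"
    using rank_normal_form[of T B] T by metis
  obtain P'' where P'': "P'' ** P' = mat 1" "P' ** P'' = mat 1"
    using B(1) by (auto simp: invertible_def)
  obtain Q'' where Q'': "Q' ** Q'' = mat 1" "Q'' ** Q' = mat 1"
    using B(2) by (auto simp: invertible_def)
  have "(P ** P'') ** B ** (Q'' ** Q) = P ** (P'' ** P') ** coord_proj T ** (Q' ** Q'') ** Q"
    by (simp add: B(3) matrix_mul_assoc)
  also have "\<dots> = A"
    by (simp add: A(3) P'' Q'')
  finally have "A = (P ** P'') ** B ** (Q'' ** Q)"
    by simp
  moreover have "invertible P''" "invertible Q''"
    using P'' Q'' by (auto simp: invertible_def)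
  ultimately show ?thesis
    using that A(1,2) invertible_mult by blast
qed

section \<open>Symmetry of realisable rank triples\<close>

text \<open>The \<open>itself\<close> arguments record the field and the index type, which the three
  numbers do not determine.\<close>

definition sum_ranks :: "'a::field itself \<Rightarrow> 'n::finite itself \<Rightarrow> nat \<Rightarrow> nat \<Rightarrow> nat \<Rightarrow> bool" where
  "sum_ranks _ _ k m r \<longleftrightarrow>
    (\<exists>B C :: 'a^'n^'n. rank B = k \<and> rank C = m \<and> rank (B + C) = r)"

lemma sum_ranks_swap:
  assumes "sum_ranks TYPE('a::field) TYPE('n::finite) k m r"
  shows "sum_ranks TYPE('a) TYPE('n) m k r"
  using assms unfolding sum_ranks_def by (metis add.commute)

text \<open>This exchanges the first and third rank; with \<open>sum_ranks_swap\<close> it generates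
  all permutations of the triple.\<close>

lemma sum_ranks_rotate:
  assumes "sum_ranks TYPE('a::field) TYPE('n::finite) k m r"
  shows "sum_ranks TYPE('a) TYPE('n) r m k"
proof -
  obtain B C :: "'a^'n^'n" where "rank B = k" "rank C = m" "rank (B + C) = r"
    using assms unfolding sum_ranks_def by blast
  then have "rank (B + C) = r \<and> rank (- C) = m \<and> rank ((B + C) + (- C)) = k"
    by (simp add: rank_uminus)
  then show ?thesis
    unfolding sum_ranks_def by blast
qed

section \<open>Explicit matrices for sorted rank triples\<close>

lemma card_index_vimage:
  assumes "bij_betw idx (UNIV :: 'n::finite set) {..<CARD('n)}" "J \<subseteq> {..<CARD('n)}"
  shows "card {i. idx i \<in> J} = card J"
proof -
  have "idx ` {i. idx i \<in> J} = J \<inter> range idx"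
    by auto
  also have "\<dots> = J"
    using assms by (simp add: bij_betw_def inf_absorb1)
  finally have "idx ` {i. idx i \<in> J} = J" .
  moreover have "inj_on idx {i. idx i \<in> J}"
    using assms(1) by (auto simp: bij_betw_def inj_on_def)
  ultimately show ?thesis
    by (metis card_image)
qed

text \<open>
  \<open>B\<close> is the sum of a nilpotent shift with \<open>k + m - r\<close> nonzero rows and an idempotent of rank
  \<open>r - m\<close>; \<open>C\<close> is its complement in the projection to the first \<open>r\<close> coordinates. If \<open>k = m = r\<close>,
  the shift moves into coordinate \<open>r\<close>, which exists because \<open>k < n\<close>.
\<close>

lemma sum_ranks_sorted_not_full:
  assumes "k \<le> m" "m \<le> r" "r \<le> k + m" "r \<le> CARD('n)" "k < CARD('n)"
  shows "sum_ranks TYPE('a::field) TYPE('n::finite) k m r"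
proof -
  let ?n = "CARD('n)"
  obtain idx where idx: "bij_betw idx (UNIV :: 'n set) {..<?n}"
    using finite_same_card_bij[of "UNIV :: 'n set" "{..<?n}"] by auto
  define g where "g = inv_into UNIV idx"
  have g: "idx (g a) = a" if "a < ?n" for a
    using that idx unfolding g_def by (intro f_inv_into_f) (auto simp: bij_betw_def)
  have inj: "idx i = idx j \<longleftrightarrow> i = j" for i j
    using idx by (auto simp: bij_betw_def inj_on_def)
  define t where "t = k + m - r"
  \<comment> \<open>If \<open>t < m\<close>, the shift uses columns below \<open>m\<close>, away
    from the idempotent; \<open>t = m\<close> forces \<open>k = m = r\<close>, and then the
    idempotent is zero.\<close>
  have t: "t \<le> m" "t + (r - m) = k" "t < m \<or> m = r \<and> t < ?n"
    using assms by (auto simp: t_def)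
  have next_lt: "Suc (idx i) < ?n" if "idx i < t" for i
    using that t assms by linarith
  define B :: "'a^'n^'n" where "B = (\<chi> i j. if idx i < t then of_bool (idx j = Suc (idx i))
     else if m \<le> idx i \<and> idx i < r then of_bool (idx j = idx i) else 0)"
  define C :: "'a^'n^'n" where "C = (\<chi> i j. if idx i < t then of_bool (idx j = idx i) - of_bool (idx j = Suc (idx i))
     else if idx i < m then of_bool (idx j = idx i) else 0)"
  have "rank B = card {i. idx i \<in> {..<t} \<union> {m..<r}}"
    by (rule rank_echelon[where p = "\<lambda>i. if idx i < t then g (Suc (idx i)) else i" and h = idx])
      (use t in \<open>auto simp: B_def vec_eq_iff g next_lt inj\<close>)
  also have "\<dots> = card ({..<t} \<union> {m..<r})"
    by (rule card_index_vimage[OF idx]) (use t assms in auto)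
  also have "\<dots> = k"
    using t by (subst card_Un_disjoint) auto
  finally have B: "rank B = k" .
  \<comment> \<open>The first \<open>m\<close> rows of \<open>C\<close> are upper triangular with
    unit diagonal.\<close>
  have "rank C = card {i. idx i \<in> {..<m}}"
    by (rule rank_echelon[where p = id and h = idx])
      (use t in \<open>auto simp: C_def vec_eq_iff inj\<close>)
  also have "\<dots> = m"
    using assms by (subst card_index_vimage[OF idx]) auto
  finally have C: "rank C = m" .
  have "B + C = (\<chi> i j. if idx i < r then of_bool (idx j = idx i) else 0)"
    using t assms by (auto simp: B_def C_def vec_eq_iff)
  also have "rank \<dots> = card {i. idx i \<in> {..<r}}"
    by (rule rank_echelon[where p = id and h = idx]) (auto simp: vec_eq_iff inj)
  also have "\<dots> = r"
    using assms by (subst card_index_vimage[OF idx]) auto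
  finally show ?thesis
    using B C unfolding sum_ranks_def by blast
qed

text \<open>
  \<open>B\<close> is the companion matrix of \<open>x\<^sup>n - x\<^bsup>n-1\<^esup> + 1\<close>, which for \<open>n > 1\<close> vanishes neither at \<open>0\<close> nor
  at \<open>1\<close> over any field, so \<open>B\<close> and \<open>C = 1 - B\<close> are both invertible.
\<close>

lemma sum_ranks_full:
  assumes n: "CARD('n) > 1"
  shows "sum_ranks TYPE('a::field) TYPE('n::finite) CARD('n) CARD('n) CARD('n)"
proof -
  let ?n = "CARD('n)"
  obtain idx where idx: "bij_betw idx (UNIV :: 'n set) {..<?n}"
    using finite_same_card_bij[of "UNIV :: 'n set" "{..<?n}"] by auto
  define g where "g = inv_into UNIV idx"
  have g: "idx (g a) = a" if "a < ?n" for a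
    using that idx unfolding g_def by (intro f_inv_into_f) (auto simp: bij_betw_def)
  have inj: "idx i = idx j \<longleftrightarrow> i = j" for i j
    using idx by (auto simp: bij_betw_def inj_on_def)
  have lt: "idx i < ?n" for i
    using idx by (auto simp: bij_betw_def)
  have last: "idx i = ?n - 1" if "\<not> Suc (idx i) < ?n" for i
    using that lt[of i] by linarith
  define p where "p i = (if Suc (idx i) < ?n then g (Suc (idx i)) else g 0)" for i
  have p: "idx (p i) = (if Suc (idx i) < ?n then Suc (idx i) else 0)" for i
    by (simp add: p_def g)
  define B :: "'a^'n^'n" where "B = (\<chi> i j. if Suc (idx i) < ?n then of_bool (idx j = Suc (idx i))
     else of_bool (idx j = idx i) - of_bool (idx j = 0))"
  define C :: "'a^'n^'n" where "C = (\<chi> i j. if Suc (idx i) < ?n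
     then of_bool (idx j = idx i) - of_bool (idx j = Suc (idx i)) else of_bool (idx j = 0))"
  have B: "rank B = ?n"
  \<comment> \<open>The last row alone meets another row's pivot column, so it comes first in the
    order.\<close>
  proof (rule rank_echelon[where p = p and h = "\<lambda>i. if Suc (idx i) < ?n then 1 else 0"])
    \<comment> \<open>Since \<open>n > 1\<close>, the two entries of the last row lie in different
      columns and do not cancel.\<close>
    show "B $ i $ p i \<noteq> 0" for i
      using n lt[of i] by (auto simp: B_def p)
    show "B $ i $ p j = 0" if "i \<noteq> j"
      "(if Suc (idx j) < ?n then 1 else 0) \<le> (if Suc (idx i) < ?n then 1 else (0::nat))" for i j
      using that last[of i] last[of j] inj[of i j] by (auto simp: B_def p split: if_splits)
  qed auto
  have C: "rank C = ?n"
  \<comment> \<open>Row \<open>i\<close> also meets the pivot column of its cyclic predecessor, so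
    \<open>h\<close> decreases with the index; the last row precedes row 0 and gets the largest
    value.\<close>
  proof (rule rank_echelon[where p = p and h = "\<lambda>i. if Suc (idx i) < ?n then ?n - idx i else Suc ?n"])
    show "C $ i $ p i \<noteq> 0" for i
      by (auto simp: C_def p)
    show "C $ i $ p j = 0" if "i \<noteq> j"
      "(if Suc (idx j) < ?n then ?n - idx j else Suc ?n) \<le> (if Suc (idx i) < ?n then ?n - idx i else Suc ?n)" for i j
      using that last[of i] last[of j] inj[of i j] by (auto simp: C_def p split: if_splits)
  qed auto
  have "B + C = (\<chi> i j. of_bool (idx j = idx i))"
    by (auto simp: B_def C_def vec_eq_iff)
  also have "rank \<dots> = ?n"
    by (rule rank_echelon[where p = id and h = idx]) (auto simp: inj)
  finally show ?thesis
    using B C unfolding sum_ranks_def by blast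
qed

section \<open>From sorted triples to the characterisation\<close>

lemma sum_ranks_sorted:
  assumes "CARD('n) > 1" "k \<le> m" "m \<le> r" "r \<le> k + m" "r \<le> CARD('n)"
  shows "sum_ranks TYPE('a::field) TYPE('n::finite) k m r"
proof (cases "k < CARD('n)")
  case True
  then show ?thesis using sum_ranks_sorted_not_full assms by blast
next
  case False
  then have "k = CARD('n)" "m = CARD('n)" "r = CARD('n)"
    using assms by auto
  then show ?thesis using sum_ranks_full assms(1) by metis
qed

text \<open>The three triangle inequalities are invariant under permutation, so the triple may be
  sorted; the cases locate \<open>r\<close> relative to \<open>k\<close> and
  \<open>m\<close>.\<close>

lemma sum_ranks_triangle:
  assumes "CARD('n) > 1" "k \<le> m" "m \<le> CARD('n)" "m \<le> r + k" "r \<le> k + m" "r \<le> CARD('n)"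
  shows "sum_ranks TYPE('a::field) TYPE('n::finite) k m r"
proof -
  note sorted = sum_ranks_sorted[where ?'n = 'n and ?'a = 'a, OF assms(1)]
  consider "m \<le> r" | "k \<le> r" "r \<le> m" | "r \<le> k"
    using assms by linarith
  then show ?thesis
  proof cases
    case 1
    then show ?thesis using sorted assms by simp
  next
    case 2
    then have "sum_ranks TYPE('a) TYPE('n) k r m"
      using sorted assms by simp
    then show ?thesis
      by (metis sum_ranks_swap sum_ranks_rotate)
  next
    case 3
    then have "sum_ranks TYPE('a) TYPE('n) r k m"
      using sorted assms by simp
    then show ?thesis
      by (metis sum_ranks_swap sum_ranks_rotate)
  qed
qed

lemma sum_of_ranks_iff:
  fixes A :: "'a::field^'n^'n"
  assumes "CARD('n) > 1" "k \<le> m" "m \<le> CARD('n)"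
  shows "(\<exists>B C. rank B = k \<and> rank C = m \<and> A = B + C) \<longleftrightarrow>
    m - k \<le> rank A \<and> rank A \<le> min (m + k) CARD('n)"
proof
  assume "\<exists>B C. rank B = k \<and> rank C = m \<and> A = B + C"
  then obtain B C where BC: "rank B = k" "rank C = m" "A = B + C" by blast
  \<comment> \<open>The lower bound is subadditivity for \<open>C = A + (- B)\<close>.\<close>
  have "rank C \<le> rank A + rank B"
    using rank_add_le[of A "- B"] BC by (simp add: rank_uminus)
  then show "m - k \<le> rank A \<and> rank A \<le> min (m + k) CARD('n)"
    using rank_add_le[of B C] rank_le_card[of A] BC by auto
next
  assume "m - k \<le> rank A \<and> rank A \<le> min (m + k) CARD('n)"
  then have "sum_ranks TYPE('a) TYPE('n) k m (rank A)"
    using assms by (intro sum_ranks_triangle) auto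
  then obtain B C :: "'a^'n^'n" where BC: "rank B = k" "rank C = m" "rank A = rank (B + C)"
    unfolding sum_ranks_def by metis
  \<comment> \<open>The realised sum only has the rank of \<open>A\<close>; an equivalence carries
    it to \<open>A\<close> and preserves the ranks of both summands.\<close>
  obtain P Q where PQ: "invertible P" "invertible Q" "A = P ** (B + C) ** Q"
    using rank_eq_imp_equivalent[OF BC(3)] .
  then have "A = P ** B ** Q + P ** C ** Q"
    by (simp add: matrix_add_ldistrib matrix_add_rdistrib)
  then show "\<exists>B C. rank B = k \<and> rank C = m \<and> A = B + C"
    using rank_mult_invertible[OF PQ(1,2)] BC by metis
qed

theorem theorem3p11:
  fixes k m :: nat
  assumes "CARD('n::finite) > 1"
    and "k \<le> m" and "m \<le> CARD('n)"
  shows "(\<forall>(A :: 'a::{field,finite}^'n^'n) r. rank A = r \<longrightarrow>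
            ((\<exists>B C. rank B = k \<and> rank C = m \<and> A = B + C) \<longleftrightarrow>
              m - k \<le> r \<and> r \<le> min (m + k) CARD('n)))
       \<and> rank_set k + rank_set m = (\<Union>i\<in>{m - k..min (m + k) CARD('n)}. rank_set i :: ('a^'n^'n) set)
       \<and> disjoint_family_on (rank_set :: nat \<Rightarrow> ('a^'n^'n) set) {m - k..min (m + k) CARD('n)}"
proof (intro conjI)
  note iff = sum_of_ranks_iff[where ?'a = 'a, OF assms]
  show "\<forall>(A :: 'a^'n^'n) r. rank A = r \<longrightarrow>
      ((\<exists>B C. rank B = k \<and> rank C = m \<and> A = B + C) \<longleftrightarrow> m - k \<le> r \<and> r \<le> min (m + k) CARD('n))"
    using iff by blast
  have "A \<in> rank_set k + rank_set m \<longleftrightarrow> (\<exists>B C. rank B = k \<and> rank C = m \<and> A = B + C)" for A :: "'a^'n^'n"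
    by (auto simp: rank_set_def set_plus_def)
  then have "A \<in> rank_set k + rank_set m \<longleftrightarrow>
      A \<in> (\<Union>i\<in>{m - k..min (m + k) CARD('n)}. rank_set i)" for A :: "'a^'n^'n"
    unfolding iff by (simp add: rank_set_def)
  then show "rank_set k + rank_set m =
      (\<Union>i\<in>{m - k..min (m + k) CARD('n)}. rank_set i :: ('a^'n^'n) set)"
    by blast
  show "disjoint_family_on (rank_set :: nat \<Rightarrow> ('a^'n^'n) set) {m - k..min (m + k) CARD('n)}"
    by (auto simp: disjoint_family_on_def rank_set_def)
qed

end
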